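(* Let $0<\beta\le1$, $f:\mathbb{R}\to\mathbb{R}$, $x\in\mathbb{R}$, and fix one of the signs $\pm$ (the same throughout). (1) If $\upsilon^{\beta}_{\pm}f(x)$ exists finitely and $\upsilon^{\beta}_{\pm}f(x)\neq0$, then, as $\epsilon\to0^+$, $$f(x\pm\epsilon)=f(x)\pm\upsilon^{\beta}_{\pm}f(x)\,\epsilon^{\beta}+o(\epsilon^{\beta}).$$ (2) Conversely, if for some real $K$ and some $\gamma=\gamma(\epsilon)$ with $\lim_{\epsilon\to0^+}\gamma=0$ one has $$f(x\pm\epsilon)=f(x)\pm K\epsilon^{\beta}+\gamma\,\epsilon^{\beta}$$ for all sufficiently small $\epsilon>0$, then $\upsilon^{\beta}_{\pm}f(x)=K$.
   Context: For $\epsilon>0$ put $\Delta^{+}_{\epsilon}[f](x)=f(x+\epsilon)-f(x)$ and $\Delta^{-}_{\epsilon}[f](x)=f(x)-f(x-\epsilon)$. The fractional velocity of order $\beta$ is $\upsilon^{\beta}_{\pm}f(x)=\lim_{\epsilon\to0^+}\Delta^{\pm}_{\epsilon}[f](x)/\epsilon^{\beta}$. The term $o(\epsilon^{\beta})$ denotes a quantity whose quotient by $\epsilon^{\beta}$ tends to $0$ as $\epsilon\to0^+$. *)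

theory Defs
  imports "HOL-Analysis.Analysis" "HOL-Library.Landau_Symbols"
begin

datatype pm_sign = Plus | Minus

primrec pm :: "real \<Rightarrow> pm_sign \<Rightarrow> real \<Rightarrow> real" ("(_ \<plusminus>\<^bsub>_\<^esub> _)" [65, 0, 66] 65) where
  "a \<plusminus>\<^bsub>Plus\<^esub> b = a + b"
| "a \<plusminus>\<^bsub>Minus\<^esub> b = a - b"

primrec increment :: "pm_sign \<Rightarrow> real \<Rightarrow> (real \<Rightarrow> real) \<Rightarrow> real \<Rightarrow> real" where
  "increment Plus e f x = f (x + e) - f x"
| "increment Minus e f x = f x - f (x - e)"

definition frac_velocity_exists :: "pm_sign \<Rightarrow> real \<Rightarrow> (real \<Rightarrow> real) \<Rightarrow> real \<Rightarrow> bool" where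
  "frac_velocity_exists s \<beta> f x \<longleftrightarrow>
     (\<exists>L::real. ((\<lambda>e. increment s e f x / e powr \<beta>) \<longlongrightarrow> L) (at_right 0))"

(* Lim is unspecified when the limit does not exist, so this value is meaningful
   only together with frac_velocity_exists. *)
definition frac_velocity :: "pm_sign \<Rightarrow> real \<Rightarrow> (real \<Rightarrow> real) \<Rightarrow> real \<Rightarrow> real" where
  "frac_velocity s \<beta> f x = Lim (at_right 0) (\<lambda>e. increment s e f x / e powr \<beta>)"

end

theory Submission
  imports Defs
begin

text \<open>Both claims say that the increment quotient tends to K exactly when the remainder of the
  expansion with coefficient K, divided by \<open>e powr \<beta>\<close>, tends to 0. Up to the
  chosen sign, the quotient minus K is this scaled remainder, and a sign does not affect convergence
  to 0. This is \<open>increment_quotient_tendsto_iff\<close>. Taking K to be the velocity gives the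
  little-o expansion; in the converse, \<gamma> is eventually the scaled remainder itself.\<close>

text \<open>The term \<open>pm 0 s a\<close> is a multiplied by the sign s. For \<open>Minus\<close>
  the increment is f x - f (x - e), so its error is the negative of the error in the expansion; this
  factor treats both signs at once.\<close>

lemma increment_eq_pm:
  "increment s e f x - v = (0 \<plusminus>\<^bsub>s\<^esub> (f (x \<plusminus>\<^bsub>s\<^esub> e) - (f x \<plusminus>\<^bsub>s\<^esub> v)))"
  by (cases s) simp_all

lemma tendsto_pm_zero:
  assumes "(g \<longlongrightarrow> 0) F"
  shows "((\<lambda>e. 0 \<plusminus>\<^bsub>s\<^esub> g e) \<longlongrightarrow> 0) F"
  using assms by (cases s) (auto intro: tendsto_eq_intros)

lemma pm_pm_zero: "(0 \<plusminus>\<^bsub>s\<^esub> (0 \<plusminus>\<^bsub>s\<^esub> a)) = a"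
  by (cases s) simp_all

lemma pm_zero_divide: "(0 \<plusminus>\<^bsub>s\<^esub> a) / c = (0 \<plusminus>\<^bsub>s\<^esub> (a / c))"
  by (cases s) simp_all

text \<open>The filter \<open>at_right 0\<close> on the reals is nontrivial, so limits along it are
  unique and \<open>Lim\<close> must return L.\<close>

lemma frac_velocity_eqI:
  assumes "((\<lambda>e. increment s e f x / e powr \<beta>) \<longlongrightarrow> L) (at_right 0)"
  shows "frac_velocity_exists s \<beta> f x" and "frac_velocity s \<beta> f x = L"
  using assms tendsto_Lim[OF _ assms]
  by (auto simp: frac_velocity_exists_def frac_velocity_def)

lemma tendsto_frac_velocity:
  assumes "frac_velocity_exists s \<beta> f x"
  shows "((\<lambda>e. increment s e f x / e powr \<beta>) \<longlongrightarrow> frac_velocity s \<beta> f x) (at_right 0)"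
  using assms frac_velocity_eqI(2) unfolding frac_velocity_exists_def by metis

text \<open>The power vanishes only at e = 0, a point that \<open>at_right 0\<close> leaves out;
  this justifies dividing by it.\<close>

lemma eventually_powr_nonzero: "\<forall>\<^sub>F e::real in at_right 0. e powr \<beta> \<noteq> 0"
  using eventually_at_right_less[of "0::real"] by eventually_elim simp

lemma increment_quotient_tendsto_iff:
  "((\<lambda>e. increment s e f x / e powr \<beta>) \<longlongrightarrow> K) (at_right 0) \<longleftrightarrow>
   ((\<lambda>e. (f (x \<plusminus>\<^bsub>s\<^esub> e) - (f x \<plusminus>\<^bsub>s\<^esub> K * e powr \<beta>)) / e powr \<beta>) \<longlongrightarrow> 0) (at_right 0)"
  (is "?A \<longleftrightarrow> (?q \<longlongrightarrow> 0) _")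
proof -
  \<comment> \<open>K is absorbed into the fraction as K * \<open>e powr \<beta>\<close> /
    \<open>e powr \<beta>\<close>, which is valid where the power is nonzero.\<close>
  have "\<forall>\<^sub>F e in at_right 0. increment s e f x / e powr \<beta> - K = (0 \<plusminus>\<^bsub>s\<^esub> ?q e)"
    using eventually_powr_nonzero[of \<beta>]
  proof eventually_elim
    case (elim e)
    then have "increment s e f x / e powr \<beta> - K = (increment s e f x - K * e powr \<beta>) / e powr \<beta>"
      by (simp add: diff_divide_distrib)
    then show ?case by (simp only: increment_eq_pm pm_zero_divide)
  qed
  then have "?A \<longleftrightarrow> ((\<lambda>e. 0 \<plusminus>\<^bsub>s\<^esub> ?q e) \<longlongrightarrow> 0) (at_right 0)"
    unfolding LIM_zero_iff[of _ K, symmetric] by (rule tendsto_cong)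
  \<comment> \<open>Applying the sign twice is the identity, so \<open>tendsto_pm_zero\<close>
    yields both directions.\<close>
  also have "\<dots> \<longleftrightarrow> (?q \<longlongrightarrow> 0) (at_right 0)"
    using tendsto_pm_zero[of "\<lambda>e. 0 \<plusminus>\<^bsub>s\<^esub> ?q e" _ s] tendsto_pm_zero[of ?q _ s]
    by (auto simp: pm_pm_zero)
  finally show ?thesis .
qed

theorem corollary2:
  fixes f :: "real \<Rightarrow> real" and x \<beta> :: real and s :: pm_sign
  assumes "0 < \<beta>" and "\<beta> \<le> 1"
  shows "(frac_velocity_exists s \<beta> f x \<and> frac_velocity s \<beta> f x \<noteq> 0 \<longrightarrow>
            (\<exists>r \<in> o[at_right 0](\<lambda>e. e powr \<beta>). \<forall>\<^sub>F e in at_right 0.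
               f (x \<plusminus>\<^bsub>s\<^esub> e) = (f x \<plusminus>\<^bsub>s\<^esub> frac_velocity s \<beta> f x * e powr \<beta>) + r e))
       \<and> (\<forall>(K::real) (\<gamma>::real \<Rightarrow> real).
            (\<gamma> \<longlongrightarrow> 0) (at_right 0) \<and>
            (\<forall>\<^sub>F e in at_right 0.
               f (x \<plusminus>\<^bsub>s\<^esub> e) = (f x \<plusminus>\<^bsub>s\<^esub> K * e powr \<beta>) + \<gamma> e * e powr \<beta>) \<longrightarrow>
            frac_velocity_exists s \<beta> f x \<and> frac_velocity s \<beta> f x = K)"
proof (intro conjI[of "_ \<longrightarrow> _"] impI allI; elim conjE)
  assume "frac_velocity_exists s \<beta> f x"
  \<comment> \<open>With r the exact remainder, the expansion holds for every e, and only its order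
    of smallness is left to prove.\<close>
  define r where "r e = f (x \<plusminus>\<^bsub>s\<^esub> e) - (f x \<plusminus>\<^bsub>s\<^esub> frac_velocity s \<beta> f x * e powr \<beta>)" for e
  have "((\<lambda>e. r e / e powr \<beta>) \<longlongrightarrow> 0) (at_right 0)"
    using tendsto_frac_velocity[OF \<open>frac_velocity_exists s \<beta> f x\<close>]
    unfolding r_def increment_quotient_tendsto_iff .
  then have "r \<in> o[at_right 0](\<lambda>e. e powr \<beta>)"
    using eventually_powr_nonzero by (rule smalloI_tendsto)
  then show "\<exists>r \<in> o[at_right 0](\<lambda>e. e powr \<beta>). \<forall>\<^sub>F e in at_right 0.
      f (x \<plusminus>\<^bsub>s\<^esub> e) = (f x \<plusminus>\<^bsub>s\<^esub> frac_velocity s \<beta> f x * e powr \<beta>) + r e"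
    by (rule bexI[rotated]) (simp add: r_def)
next
  fix K :: real and \<gamma> :: "real \<Rightarrow> real"
  assume \<gamma>: "(\<gamma> \<longlongrightarrow> 0) (at_right 0)"
    and expansion: "\<forall>\<^sub>F e in at_right 0.
      f (x \<plusminus>\<^bsub>s\<^esub> e) = (f x \<plusminus>\<^bsub>s\<^esub> K * e powr \<beta>) + \<gamma> e * e powr \<beta>"
  \<comment> \<open>Solving the expansion for \<gamma> identifies it with the scaled remainder near
    0, which therefore inherits its limit 0.\<close>
  have "\<forall>\<^sub>F e in at_right 0.
      \<gamma> e = (f (x \<plusminus>\<^bsub>s\<^esub> e) - (f x \<plusminus>\<^bsub>s\<^esub> K * e powr \<beta>)) / e powr \<beta>"
    using expansion eventually_powr_nonzero[of \<beta>] by eventually_elim simp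
  from Lim_transform_eventually[OF \<gamma> this]
  have "((\<lambda>e. increment s e f x / e powr \<beta>) \<longlongrightarrow> K) (at_right 0)"
    unfolding increment_quotient_tendsto_iff .
  then show "frac_velocity_exists s \<beta> f x \<and> frac_velocity s \<beta> f x = K"
    using frac_velocity_eqI by blast
qed

end
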